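(* Let $A$ be a real $m\times n$ matrix whose minimal entry is $0$ and maximal entry is $1$, such that no pure action of Player 2 is optimal for him in the one-shot matrix game $A$. Let $S$ be a symmetric $n\times n$ switching-cost matrix, let $c\ge0$, and put $M=\max_{y\in\Delta(\{1,\dots,n\})}y^TSy$. Then Player 2's loss from limiting himself to static strategies in the game $(A,S,c)$ satisfies $$\tilde v(c)-v(c)\ \le\ \Delta(c)=\tfrac12\,(1-v(c))+\tfrac c4\,M .$$ This implies $$\frac{1+cM-\tilde v(c)}{1+cM-v(c)}\ \ge\ \frac12 .$$
   Context: A zero-sum game with switching costs is a tuple $(A,S,c)$ where $A=(a_{ij})$ is a real $m\times n$ matrix, $c\ge 0$, and $S=(s_{kj})$ is an $n\times n$ matrix (a switching-cost matrix) with $s_{kj}\ge 0$, $s_{jj}=0$ for all $k,j$, normalized so that its smallest nonzero entry is $1$. At each stage $t=1,2,\dots$, Player 1 (the maximizer) chooses a row $i(t)$ and Player 2 (the minimizer) simultaneously chooses a column $j(t)$, possibly at random, knowing the history of realized actions. The stage payoff, paid by Player 2 to Player 1, is $u_t=a_{i(t)j(t)}+c\,s_{j(t-1)j(t)}$, with no switching cost paid at $t=1$. For a strategy pair $(\sigma,\tau)$ the payoff is $\gamma(\sigma,\tau)=\mathbb{E}_{\sigma,\tau}\big(\liminf_{T\to\infty}\frac1T\sum_{t=1}^T u_t\big)$. A stationary strategy is one in which the mixed action at stage $t$ depends only on the previous action $j(t-1)$ of Player 2 (at stage 1 a fixed arbitrary initial state $j(0)$ plays the role of the previous action). The game has a value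 $v(c)$, attained by stationary strategies of both players. A static strategy plays the same mixed action at every stage regardless of history. The minimax value in static strategies is $\tilde v(c)=\min_{y\in\Delta(\{1,\dots,n\})}\max_{x\in\Delta(\{1,\dots,m\})}\{x^TAy+c\,y^TSy\}$. *)

theory Defs
  imports "HOL-Analysis.Analysis" "HOL-Probability.Probability"
begin

section \<open>Mixed actions and the one-shot game\<close>

definition mixed :: "(real ^ 'n) set" where
  "mixed = {y. (\<forall>j. 0 \<le> y $ j) \<and> (\<Sum>j\<in>UNIV. y $ j) = 1}"

text \<open>The set \<open>mixed\<close> is compact, so every \<open>SUP\<close> and \<open>INF\<close> over it below is a maximum or minimum.\<close>

definition one_shot_loss :: "real ^ 'n ^ 'm \<Rightarrow> real ^ 'n \<Rightarrow> real" where
  "one_shot_loss A y = (SUP x\<in>mixed. x \<bullet> (A *v y))"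

definition one_shot_optimal :: "real ^ 'n ^ 'm \<Rightarrow> real ^ 'n \<Rightarrow> bool" where
  "one_shot_optimal A y \<longleftrightarrow> y \<in> mixed \<and> (\<forall>y'\<in>mixed. one_shot_loss A y \<le> one_shot_loss A y')"

definition pure_action :: "'n \<Rightarrow> real ^ 'n" where
  "pure_action j = axis j 1"


section \<open>Switching costs\<close>

text \<open>The entry \<open>S $ k $ j\<close> is the cost of moving from column \<open>k\<close> to column \<open>j\<close>. The
  normalization (the smallest nonzero entry is \<open>1\<close>) includes that there is a nonzero entry.\<close>

definition switching_cost_matrix :: "real ^ 'n ^ 'n \<Rightarrow> bool" where
  "switching_cost_matrix S \<longleftrightarrow>
     (\<forall>k j. 0 \<le> S $ k $ j) \<and> (\<forall>j. S $ j $ j = 0) \<and>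
     (\<exists>k j. S $ k $ j = 1) \<and> (\<forall>k j. S $ k $ j \<noteq> 0 \<longrightarrow> 1 \<le> S $ k $ j)"

definition static_value :: "real ^ 'n ^ 'm \<Rightarrow> real ^ 'n ^ 'n \<Rightarrow> real \<Rightarrow> real" where
  "static_value A S c = (INF y\<in>mixed. SUP x\<in>mixed. x \<bullet> (A *v y) + c * (y \<bullet> (S *v y)))"

definition max_static_switching :: "real ^ 'n ^ 'n \<Rightarrow> real" where
  "max_static_switching S = (SUP y\<in>mixed. y \<bullet> (S *v y))"


section \<open>The repeated game\<close>

text \<open>Behaviour strategies: the argument is the list of action pairs realized so far, the oldest
  first.\<close>

type_synonym ('m, 'n) strategy1 = "('m \<times> 'n) list \<Rightarrow> 'm pmf"
type_synonym ('m, 'n) strategy2 = "('m \<times> 'n) list \<Rightarrow> 'n pmf"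

text \<open>Stages are numbered from \<open>0\<close>. Given the history, the two players randomize independently.\<close>

definition stage_law ::
  "('m, 'n) strategy1 \<Rightarrow> ('m, 'n) strategy2 \<Rightarrow> nat \<Rightarrow> (nat \<Rightarrow> 'm \<times> 'n) \<Rightarrow> ('m \<times> 'n) measure" where
  "stage_law \<sigma> \<tau> t \<omega> =
     measure_pmf (pair_pmf (\<sigma> (map \<omega> [0..<t])) (\<tau> (map \<omega> [0..<t])))"

text \<open>The law of the infinite play, given by the Ionescu-Tulcea theorem.\<close>

definition play_measure ::
  "('m, 'n) strategy1 \<Rightarrow> ('m, 'n) strategy2 \<Rightarrow> (nat \<Rightarrow> 'm \<times> 'n) measure" where
  "play_measure \<sigma> \<tau> =
     projective_family.lim UNIV
       (Ionescu_Tulcea.CI (stage_law \<sigma> \<tau>) (\<lambda>_. count_space UNIV)) (\<lambda>_. count_space UNIV)"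

definition stage_payoff ::
  "real ^ 'n ^ 'm \<Rightarrow> real ^ 'n ^ 'n \<Rightarrow> real \<Rightarrow> (nat \<Rightarrow> 'm \<times> 'n) \<Rightarrow> nat \<Rightarrow> real" where
  "stage_payoff A S c \<omega> t =
     A $ fst (\<omega> t) $ snd (\<omega> t) + (if t = 0 then 0 else c * S $ snd (\<omega> (t - 1)) $ snd (\<omega> t))"

definition long_run_payoff ::
  "real ^ 'n ^ 'm \<Rightarrow> real ^ 'n ^ 'n \<Rightarrow> real \<Rightarrow> (nat \<Rightarrow> 'm \<times> 'n) \<Rightarrow> real" where
  "long_run_payoff A S c \<omega> =
     real_of_ereal (liminf (\<lambda>T. ereal ((\<Sum>t<T. stage_payoff A S c \<omega> t) / real T)))"

definition payoff ::
  "real ^ 'n ^ 'm \<Rightarrow> real ^ 'n ^ 'n \<Rightarrow> real \<Rightarrow> ('m, 'n) strategy1 \<Rightarrow> ('m, 'n) strategy2 \<Rightarrow> real" where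
  "payoff A S c \<sigma> \<tau> = (\<integral>\<omega>. long_run_payoff A S c \<omega> \<partial>play_measure \<sigma> \<tau>)"

text \<open>The value, defined for every game as the supremum of what Player 1 can guarantee against all
  strategies of Player 2. It is known that the game has a value and that both players have optimal
  strategies; by \<open>game_value_eqI\<close> below, that value is \<open>game_value\<close>.\<close>

definition game_value :: "real ^ 'n ^ 'm \<Rightarrow> real ^ 'n ^ 'n \<Rightarrow> real \<Rightarrow> real" where
  "game_value A S c = (SUP \<sigma>. INF \<tau>. payoff A S c \<sigma> \<tau>)"


section \<open>The play measure and the value are well-defined\<close>

lemma Ionescu_Tulcea_stage_law:
  fixes \<sigma> :: "('m::finite, 'n::finite) strategy1" and \<tau> :: "('m, 'n) strategy2"
  shows "Ionescu_Tulcea (stage_law \<sigma> \<tau>) (\<lambda>_. count_space UNIV)"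
proof (rule Ionescu_Tulcea.intro)
  fix t :: nat
  have *: "sets (PiM {0..<t} (\<lambda>_. count_space (UNIV :: ('m \<times> 'n) set))) =
      sets (count_space (PiE {0..<t} (\<lambda>_. UNIV)))"
    by (subst count_space_PiM_finite) auto
  show "stage_law \<sigma> \<tau> t \<in>
      measurable (PiM {0..<t} (\<lambda>_. count_space UNIV)) (subprob_algebra (count_space UNIV))"
    unfolding measurable_cong_sets[OF * refl]
    by (auto simp: stage_law_def space_subprob_algebra intro: measure_pmf.subprob_space_axioms)
qed (simp add: stage_law_def measure_pmf.prob_space_axioms)

lemma prob_space_play_measure:
  fixes \<sigma> :: "('m::finite, 'n::finite) strategy1" and \<tau> :: "('m, 'n) strategy2"
  shows "prob_space (play_measure \<sigma> \<tau>)"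
proof -
  interpret Ionescu_Tulcea "stage_law \<sigma> \<tau>" "\<lambda>_. count_space UNIV"
    by (rule Ionescu_Tulcea_stage_law)
  have "emeasure PF.lim (prod_emb UNIV (\<lambda>_. count_space UNIV) {} {\<lambda>_. undefined}) =
      emeasure (CI {}) {\<lambda>_. undefined}"
    by (rule lim) (auto simp: sets_PiM_empty)
  moreover have "{\<lambda>_. undefined} = space (CI {})"
    by (simp add: CI_def space_PiM)
  moreover have "prob_space (CI {})"
    by (rule PF.prob_space_P) auto
  moreover have "prod_emb UNIV (\<lambda>_. count_space UNIV) {} {\<lambda>_. undefined} = space PF.lim"
    by (auto simp: prod_emb_def space_PiM)
  ultimately have "emeasure PF.lim (space PF.lim) = 1"
    by (metis prob_space.emeasure_space_1)
  then show ?thesis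
    unfolding play_measure_def by (rule prob_spaceI)
qed

lemma stage_payoff_bounded:
  fixes A :: "real ^ 'n::finite ^ 'm::finite"
  obtains B where "0 \<le> B" "\<And>\<omega> t. \<bar>stage_payoff A S c \<omega> t\<bar> \<le> B"
proof -
  define a where "a = (\<Sum>i\<in>UNIV. \<Sum>j\<in>UNIV. \<bar>A $ i $ j\<bar>)"
  define s where "s = (\<Sum>k\<in>UNIV. \<Sum>j\<in>UNIV. \<bar>S $ k $ j\<bar>)"
  have a: "\<bar>A $ i $ j\<bar> \<le> a" for i j
  proof -
    have "\<bar>A $ i $ j\<bar> \<le> (\<Sum>j\<in>UNIV. \<bar>A $ i $ j\<bar>)"
      by (rule member_le_sum) auto
    also have "\<dots> \<le> a"
      unfolding a_def by (rule member_le_sum[where f="\<lambda>i. \<Sum>j\<in>UNIV. \<bar>A $ i $ j\<bar>"])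
        (auto intro: sum_nonneg)
    finally show ?thesis .
  qed
  have s: "\<bar>S $ k $ j\<bar> \<le> s" for k j
  proof -
    have "\<bar>S $ k $ j\<bar> \<le> (\<Sum>j\<in>UNIV. \<bar>S $ k $ j\<bar>)"
      by (rule member_le_sum) auto
    also have "\<dots> \<le> s"
      unfolding s_def by (rule member_le_sum[where f="\<lambda>k. \<Sum>j\<in>UNIV. \<bar>S $ k $ j\<bar>"])
        (auto intro: sum_nonneg)
    finally show ?thesis .
  qed
  have nonneg: "0 \<le> a" "0 \<le> s"
    by (auto simp: a_def s_def intro!: sum_nonneg)
  have "\<bar>stage_payoff A S c \<omega> t\<bar> \<le> a + \<bar>c\<bar> * s" for \<omega> t
  proof -
    have "\<bar>c * S $ k $ j\<bar> \<le> \<bar>c\<bar> * s" for k j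
      using s by (simp add: abs_mult mult_left_mono)
    moreover have "0 \<le> \<bar>c\<bar> * s"
      using nonneg by simp
    ultimately have "\<bar>if t = 0 then 0 else c * S $ snd (\<omega> (t - 1)) $ snd (\<omega> t)\<bar> \<le> \<bar>c\<bar> * s"
      by auto
    then show ?thesis
      unfolding stage_payoff_def
      by (intro order_trans[OF abs_triangle_ineq] add_mono a) auto
  qed
  moreover have "0 \<le> a + \<bar>c\<bar> * s"
    using nonneg by simp
  ultimately show ?thesis
    using that by blast
qed

lemma payoff_bounded:
  fixes A :: "real ^ 'n::finite ^ 'm::finite"
  obtains B where "\<And>\<sigma> \<tau>. \<bar>payoff A S c \<sigma> \<tau>\<bar> \<le> B"
proof -
  obtain B where B: "0 \<le> B" "\<And>\<omega> t. \<bar>stage_payoff A S c \<omega> t\<bar> \<le> B"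
    using stage_payoff_bounded by blast
  have avg: "\<bar>(\<Sum>t<T. stage_payoff A S c \<omega> t) / real T\<bar> \<le> B" for \<omega> T
  proof -
    have "\<bar>\<Sum>t<T. stage_payoff A S c \<omega> t\<bar> \<le> real T * B"
      using B by (intro order_trans[OF sum_abs] order_trans[OF sum_bounded_above]) auto
    then show ?thesis
      using B(1) by (cases "T = 0") (auto simp: field_simps)
  qed
  have lr: "\<bar>long_run_payoff A S c \<omega>\<bar> \<le> B" for \<omega>
  proof -
    let ?X = "\<lambda>T. ereal ((\<Sum>t<T. stage_payoff A S c \<omega> t) / real T)"
    have b: "ereal (- B) \<le> ?X T" "?X T \<le> ereal B" for T
      using avg[of \<omega> T] by (simp_all only: ereal_less_eq abs_le_iff) linarith+
    have "ereal (- B) \<le> liminf ?X"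
      by (rule Liminf_bounded) (use b in auto)
    moreover have "liminf ?X \<le> ereal B"
      by (rule order_trans[OF Liminf_le_Limsup Limsup_bounded]) (use b in auto)
    ultimately show ?thesis
      unfolding long_run_payoff_def by (cases "liminf ?X") auto
  qed
  have "\<bar>payoff A S c \<sigma> \<tau>\<bar> \<le> B" for \<sigma> \<tau>
  proof -
    interpret prob_space "play_measure \<sigma> \<tau>"
      by (rule prob_space_play_measure)
    have "\<bar>payoff A S c \<sigma> \<tau>\<bar> \<le> (\<integral>\<omega>. \<bar>long_run_payoff A S c \<omega>\<bar> \<partial>play_measure \<sigma> \<tau>)"
      unfolding payoff_def by (rule integral_abs_bound)
    also have "\<dots> \<le> (\<integral>\<omega>. B \<partial>play_measure \<sigma> \<tau>)"
      by (rule integral_mono') (use B lr in auto)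
    also have "\<dots> = B"
      by (simp add: prob_space)
    finally show ?thesis .
  qed
  then show ?thesis
    using that by blast
qed

lemma game_value_eqI:
  fixes A :: "real ^ 'n::finite ^ 'm::finite"
  assumes 1: "\<And>\<tau>. v \<le> payoff A S c \<sigma>' \<tau>" and 2: "\<And>\<sigma>. payoff A S c \<sigma> \<tau>' \<le> v"
  shows "game_value A S c = v" "(INF \<tau>. SUP \<sigma>. payoff A S c \<sigma> \<tau>) = v"
proof -
  obtain B where B: "\<And>\<sigma> \<tau>. \<bar>payoff A S c \<sigma> \<tau>\<bar> \<le> B"
    using payoff_bounded by blast
  have below: "bdd_below (range (payoff A S c \<sigma>))" for \<sigma>
    using B by (auto simp: abs_le_iff intro!: bdd_belowI[of _ "- B"]) (smt (verit, ccfv_SIG))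
  have above: "bdd_above (range (\<lambda>\<sigma>. payoff A S c \<sigma> \<tau>))" for \<tau>
    using B by (auto simp: abs_le_iff intro!: bdd_aboveI[of _ B])
  have inf_le: "(INF \<tau>. payoff A S c \<sigma> \<tau>) \<le> v" for \<sigma>
    using 2 by (intro cINF_lower2[OF below, of \<tau>']) auto
  have le_sup: "v \<le> (SUP \<sigma>. payoff A S c \<sigma> \<tau>)" for \<tau>
    using 1 by (intro cSUP_upper2[OF above, of \<sigma>']) auto
  show "game_value A S c = v"
    unfolding game_value_def
  proof (rule antisym)
    show "(SUP \<sigma>. INF \<tau>. payoff A S c \<sigma> \<tau>) \<le> v"
      using inf_le by (intro cSUP_least) auto
    have "v \<le> (INF \<tau>. payoff A S c \<sigma>' \<tau>)"
      using 1 by (intro cINF_greatest) auto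
    then show "v \<le> (SUP \<sigma>. INF \<tau>. payoff A S c \<sigma> \<tau>)"
      using inf_le by (intro cSUP_upper2[of _ _ \<sigma>'] bdd_aboveI[of _ v]) auto
  qed
  show "(INF \<tau>. SUP \<sigma>. payoff A S c \<sigma> \<tau>) = v"
  proof (rule antisym)
    show "v \<le> (INF \<tau>. SUP \<sigma>. payoff A S c \<sigma> \<tau>)"
      using le_sup by (intro cINF_greatest) auto
    have "(SUP \<sigma>. payoff A S c \<sigma> \<tau>') \<le> v"
      using 2 by (intro cSUP_least) auto
    then show "(INF \<tau>. SUP \<sigma>. payoff A S c \<sigma> \<tau>) \<le> v"
      using le_sup by (intro cINF_lower2[of _ _ \<tau>'] bdd_belowI[of _ v]) auto
  qed
qed

end

theory Submission
  imports Defs "HOL-Library.Discrete_Functions" "HOL-Real_Asymp.Real_Asymp"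
begin

text \<open>
  Both claims reduce to the lower bound \<open>w \<le> v\<close> with \<open>w = 2 v\<^sub>s - 1 - cM/2\<close>, where \<open>v\<close> is the
  value and \<open>v\<^sub>s\<close> the static value, together with \<open>v < 1 + cM\<close>, which keeps the denominator
  of the ratio positive.

  The lower bound comes from one family of static strategies. Suppose that in state \<open>k\<close> (the last
  column played was \<open>k\<close>) Player 2 contemplates a mixed action \<open>y\<close>. Compare it with the static
  strategy \<open>z = (e\<^sub>k + y)/2\<close>, which mixes staying put with moving according to \<open>y\<close>. The pure
  action \<open>e\<^sub>k\<close> costs at most \<open>1\<close> in \<open>A\<close>, so the loss of \<open>z\<close> in \<open>A\<close> is at most
  \<open>1/2\<close> plus half of the loss of \<open>y\<close>. As \<open>S\<close> is symmetric with zero diagonal, the switching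
  rate of \<open>z\<close> is \<open>(S y)\<^sub>k / 2\<close> plus a quarter of that of \<open>y\<close>, and the latter is at most \<open>M\<close>. Hence
  \<open>v\<^sub>s \<le> (1 + max\<^sub>i (A y)\<^sub>i + c (S y)\<^sub>k) / 2 + cM/4\<close>, which says exactly that \<open>y\<close> costs Player 2
  at least \<open>w\<close> in the one-shot game with entries \<open>a\<^sub>i\<^sub>j + c s\<^sub>k\<^sub>j\<close> (\<open>half_static_loss\<close>).

  This holds for all \<open>y\<close>, so by the minimax theorem (\<open>minimax_threshold\<close>) Player 1 has a mixed
  action \<open>x\<^sub>k\<close> securing \<open>w\<close> in that one-shot game. Playing \<open>x\<^sub>k\<close> in every state \<open>k\<close> makes the
  conditional expectation of each stage payoff after the first at least \<open>w\<close>, whatever Player 2 does.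

  The payoff of the repeated game is the expectation of a limit inferior, for which Fatou's lemma
  goes the wrong way for Player 1. The passage from conditional expectations to long-run payoffs is
  therefore made almost surely, by a strong law of large numbers for bounded martingale differences
  along the play (\<open>strong_law_play\<close>).

  For the strict upper bound Player 2 uses equally myopic strategies. If \<open>c > 0\<close> he never
  switches, and pays at most \<open>1 < 1 + cM\<close>. If \<open>c = 0\<close> he plays a mixed action whose one-shot loss
  is below that of a pure action, hence below \<open>1\<close>; such an action exists because no pure action is
  optimal.
\<close>

section \<open>A strong law of large numbers along the play\<close>

lemma sets_play_measure [measurable_cong]:
  fixes \<sigma> :: "('m::finite, 'n::finite) strategy1" and \<tau> :: "('m, 'n) strategy2"
  shows "sets (play_measure \<sigma> \<tau>) = sets (PiM UNIV (\<lambda>_. count_space UNIV))"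
proof -
  interpret Ionescu_Tulcea "stage_law \<sigma> \<tau>" "\<lambda>_. count_space UNIV"
    by (rule Ionescu_Tulcea_stage_law)
  show ?thesis
    unfolding play_measure_def by (rule PF.sets_lim)
qed

text \<open>Finitely many coordinates in a finite set carry the discrete \<open>\<sigma>\<close>-algebra, so measurability in
  them is automatic.\<close>

lemma measurable_finite_PiM_count_space:
  fixes f :: "(nat \<Rightarrow> 'a::finite) \<Rightarrow> 'b"
  assumes "\<And>x. f x \<in> space N"
  shows "f \<in> measurable (PiM {0..<t} (\<lambda>_. count_space UNIV)) N"
proof -
  have *: "sets (PiM {0..<t} (\<lambda>_. count_space (UNIV :: 'a set))) =
      sets (count_space (PiE {0..<t} (\<lambda>_. UNIV)))"
    by (subst count_space_PiM_finite) auto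
  show ?thesis
    unfolding measurable_cong_sets[OF * refl] using assms by auto
qed

lemma measurable_history [measurable]:
  "(\<lambda>\<omega>. map \<omega> [0..<t]) \<in> measurable (PiM UNIV (\<lambda>_. count_space (UNIV :: 'a::finite set))) (count_space UNIV)"
proof -
  have "(\<lambda>\<omega>. (\<lambda>\<omega>'. map \<omega>' [0..<t]) (restrict \<omega> {0..<t}))
      \<in> measurable (PiM UNIV (\<lambda>_. count_space (UNIV :: 'a set))) (count_space UNIV)"
    by (intro measurable_compose[OF measurable_restrict_subset measurable_finite_PiM_count_space]) auto
  moreover have "map (restrict \<omega> {0..<t}) [0..<t] = map \<omega> [0..<t]" for \<omega> :: "nat \<Rightarrow> 'a"
    by simp
  ultimately show ?thesis by simp
qed

text \<open>The defining property of the play, in the form of an iterated expectation over histories. Later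
  arguments see the transition kernels of the Ionescu-Tulcea construction only through it.\<close>

lemma nn_integral_play_measure_Suc:
  fixes \<sigma> :: "('m::finite, 'n::finite) strategy1" and \<tau> :: "('m, 'n) strategy2"
    and F :: "('m \<times> 'n) list \<Rightarrow> ennreal"
  shows "(\<integral>\<^sup>+\<omega>. F (map \<omega> [0..<Suc t]) \<partial>play_measure \<sigma> \<tau>) =
    (\<integral>\<^sup>+\<omega>. (\<integral>\<^sup>+a. F (map \<omega> [0..<t] @ [a])
        \<partial>measure_pmf (pair_pmf (\<sigma> (map \<omega> [0..<t])) (\<tau> (map \<omega> [0..<t])))) \<partial>play_measure \<sigma> \<tau>)"
proof -
  interpret Ionescu_Tulcea "stage_law \<sigma> \<tau>" "\<lambda>_. count_space UNIV"
    by (rule Ionescu_Tulcea_stage_law)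
  let ?M = "\<lambda>_::nat. count_space (UNIV :: ('m \<times> 'n) set)"
  (* The play restricted to its first n stages is the n-step kernel composition C 0 n. *)
  have initial: "(\<integral>\<^sup>+\<omega>. G (map \<omega> [0..<n]) \<partial>play_measure \<sigma> \<tau>) =
      (\<integral>\<^sup>+\<omega>. G (map \<omega> [0..<n]) \<partial>C 0 n (\<lambda>_. undefined))" for G :: "('m \<times> 'n) list \<Rightarrow> ennreal" and n
  proof -
    have "up_to {0..<n} = n"
      by (metis atLeastLessThan_iff finite_atLeastLessThan le_eq_less_or_eq less_irrefl nat_le_linear
          up_to_iff up_to_less zero_le)
    then have CI: "CI {0..<n} = C 0 n (\<lambda>_. undefined)"
      unfolding CI_def using distr_C[of n n "\<lambda>_. undefined" 0] by simp
    have "(\<integral>\<^sup>+\<omega>. G (map \<omega> [0..<n]) \<partial>C 0 n (\<lambda>_. undefined)) =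
        (\<integral>\<^sup>+\<omega>. G (map \<omega> [0..<n]) \<partial>distr PF.lim (PiM {0..<n} ?M) (\<lambda>x. restrict x {0..<n}))"
      by (simp add: distr_lim CI)
    also have "\<dots> = (\<integral>\<^sup>+\<omega>. G (map (restrict \<omega> {0..<n}) [0..<n]) \<partial>PF.lim)"
      by (intro nn_integral_distr measurable_finite_PiM_count_space)
        (simp_all add: measurable_cong_sets[OF PF.sets_lim refl] measurable_restrict_subset
          measurable_finite_PiM_count_space)
    also have "\<dots> = (\<integral>\<^sup>+\<omega>. G (map \<omega> [0..<n]) \<partial>PF.lim)"
      by (intro nn_integral_cong arg_cong[of _ _ G]) simp
    finally show ?thesis
      unfolding play_measure_def ..
  qed
  have "(\<integral>\<^sup>+\<omega>. F (map \<omega> [0..<Suc t]) \<partial>C 0 (Suc t) (\<lambda>_. undefined)) =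
      (\<integral>\<^sup>+x. \<integral>\<^sup>+\<omega>. F (map \<omega> [0..<Suc t]) \<partial>eP t x \<partial>C 0 t (\<lambda>_. undefined))"
    unfolding C.simps add_0
    by (rule nn_integral_bind[where B="PiM {0..<Suc t} ?M"])
      (auto intro!: measurable_finite_PiM_count_space simp: measurable_cong_sets[OF sets_C refl] simp del: upt_Suc)
  also have "\<dots> = (\<integral>\<^sup>+x. \<integral>\<^sup>+a. F (map x [0..<t] @ [a])
        \<partial>measure_pmf (pair_pmf (\<sigma> (map x [0..<t])) (\<tau> (map x [0..<t]))) \<partial>C 0 t (\<lambda>_. undefined))"
  proof (rule nn_integral_cong)
    fix x assume "x \<in> space (C 0 t (\<lambda>_. undefined))"
    then have x: "x \<in> space (PiM {0..<t} ?M)"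
      by (simp add: space_C)
    have "(\<integral>\<^sup>+\<omega>. F (map \<omega> [0..<Suc t]) \<partial>eP t x) =
        (\<integral>\<^sup>+a. F (map (fun_upd x t a) [0..<Suc t]) \<partial>stage_law \<sigma> \<tau> t x)"
      by (intro nn_integral_eP[OF x] measurable_finite_PiM_count_space) simp
    then show "(\<integral>\<^sup>+\<omega>. F (map \<omega> [0..<Suc t]) \<partial>eP t x) = (\<integral>\<^sup>+a. F (map x [0..<t] @ [a])
        \<partial>measure_pmf (pair_pmf (\<sigma> (map x [0..<t])) (\<tau> (map x [0..<t]))))"
      by (simp add: stage_law_def)
  qed
  finally show ?thesis
    unfolding initial[of F]
    using initial[of "\<lambda>h. \<integral>\<^sup>+a. F (h @ [a]) \<partial>measure_pmf (pair_pmf (\<sigma> h) (\<tau> h))" t] by simp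
qed

text \<open>Martingale differences are orthogonal: given the history, the cross term of the square has mean
  zero, so each stage adds at most \<open>B\<^sup>2\<close> to the second moment.\<close>

lemma second_moment_martingale:
  fixes \<sigma> :: "('m::finite, 'n::finite) strategy1" and \<tau> :: "('m, 'n) strategy2"
    and D :: "('m \<times> 'n) list \<Rightarrow> 'm \<times> 'n \<Rightarrow> real"
  assumes bound: "\<And>h a. \<bar>D h a\<bar> \<le> B"
    and centred: "\<And>h. (\<integral>a. D h a \<partial>measure_pmf (pair_pmf (\<sigma> h) (\<tau> h))) = 0"
  shows "(\<integral>\<^sup>+\<omega>. ennreal ((\<Sum>t<T. D (map \<omega> [0..<t]) (\<omega> t))\<^sup>2) \<partial>play_measure \<sigma> \<tau>) \<le> ennreal (real T * B\<^sup>2)"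
proof (induction T)
  case 0
  then show ?case by simp
next
  case (Suc T)
  interpret prob_space "play_measure \<sigma> \<tau>"
    by (rule prob_space_play_measure)
  (* The partial sum written as a function of the history alone. *)
  define W where "W h = (\<Sum>t<length h. D (take t h) (h ! t))" for h :: "('m \<times> 'n) list"
  have W: "(\<Sum>t<T. D (map \<omega> [0..<t]) (\<omega> t)) = W (map \<omega> [0..<T])" for \<omega> T
    unfolding W_def by (auto intro!: sum.cong simp: take_map)
  have W_snoc: "W (h @ [a]) = W h + D h a" for h a
    by (simp add: W_def nth_append)
  have step: "(\<integral>\<^sup>+a. ennreal ((W (h @ [a]))\<^sup>2) \<partial>measure_pmf (pair_pmf (\<sigma> h) (\<tau> h)))
      \<le> ennreal ((W h)\<^sup>2) + ennreal (B\<^sup>2)" for h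
  proof -
    let ?q = "measure_pmf (pair_pmf (\<sigma> h) (\<tau> h))"
    have int: "integrable ?q f" for f :: "'m \<times> 'n \<Rightarrow> real"
      by (intro integrable_measure_pmf_finite) simp
    have "(\<integral>\<^sup>+a. ennreal ((W (h @ [a]))\<^sup>2) \<partial>?q) = ennreal (\<integral>a. (W (h @ [a]))\<^sup>2 \<partial>?q)"
      by (intro nn_integral_eq_integral int) simp
    also have "(\<integral>a. (W (h @ [a]))\<^sup>2 \<partial>?q) = (\<integral>a. (W h)\<^sup>2 + 2 * W h * D h a + (D h a)\<^sup>2 \<partial>?q)"
      by (simp add: W_snoc power2_sum algebra_simps)
    also have "\<dots> = (W h)\<^sup>2 + (\<integral>a. (D h a)\<^sup>2 \<partial>?q)"
      using centred[of h] by (simp add: int)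
    also have "\<dots> \<le> (W h)\<^sup>2 + (\<integral>a. B\<^sup>2 \<partial>?q)"
      by (intro add_left_mono integral_mono int) (use bound in \<open>simp add: abs_le_square_iff[symmetric] order_trans[OF _ abs_ge_self]\<close>)
    finally show ?thesis
      by (simp add: ennreal_leI flip: ennreal_plus)
  qed
  have "(\<integral>\<^sup>+\<omega>. ennreal ((\<Sum>t<Suc T. D (map \<omega> [0..<t]) (\<omega> t))\<^sup>2) \<partial>play_measure \<sigma> \<tau>)
      \<le> (\<integral>\<^sup>+\<omega>. ennreal ((W (map \<omega> [0..<T]))\<^sup>2) + ennreal (B\<^sup>2) \<partial>play_measure \<sigma> \<tau>)"
    unfolding W nn_integral_play_measure_Suc[where F = "\<lambda>h. ennreal ((W h)\<^sup>2)"]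
    by (intro nn_integral_mono step)
  also have "\<dots> = (\<integral>\<^sup>+\<omega>. ennreal ((W (map \<omega> [0..<T]))\<^sup>2) \<partial>play_measure \<sigma> \<tau>) + ennreal (B\<^sup>2)"
    by (subst nn_integral_add) (simp_all add: emeasure_space_1)
  also have "\<dots> \<le> ennreal (real T * B\<^sup>2) + ennreal (B\<^sup>2)"
    using Suc.IH by (intro add_right_mono) (simp add: W)
  also have "\<dots> = ennreal (real (Suc T) * B\<^sup>2)"
    by (simp add: algebra_simps flip: ennreal_plus)
  finally show ?case .
qed

text \<open>Second moments control averages only along a sparse sequence of times. The squares are sparse enough
  for summability and dense enough for interpolation: between \<open>n\<^sup>2\<close> and \<open>(n + 1)\<^sup>2\<close> a sum of
  bounded terms changes by at most \<open>(2 n + 1) B\<close>, which is negligible compared with \<open>n\<^sup>2\<close>.\<close>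

lemma averages_tendsto_0_of_squares:
  fixes d :: "nat \<Rightarrow> real"
  assumes bound: "\<And>t. \<bar>d t\<bar> \<le> B"
    and squares: "(\<lambda>n. (\<Sum>t<n\<^sup>2. d t) / real (n\<^sup>2)) \<longlonglongrightarrow> 0"
  shows "(\<lambda>T. (\<Sum>t<T. d t) / real T) \<longlonglongrightarrow> 0"
proof -
  define r where "r T = floor_sqrt T" for T
  define e where "e n = \<bar>(\<Sum>t<n\<^sup>2. d t) / real (n\<^sup>2)\<bar> + (2 * real n + 1) * B / real (n\<^sup>2)" for n
  have B: "0 \<le> B"
    using bound[of 0] by linarith
  have "filterlim r at_top sequentially"
    unfolding r_def filterlim_at_top
  proof
    fix Z :: nat
    show "eventually (\<lambda>T. Z \<le> floor_sqrt T) sequentially"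
      using eventually_ge_at_top[of "Z\<^sup>2"] by eventually_elim (simp add: le_floor_sqrt_iff)
  qed
  moreover have "e \<longlonglongrightarrow> 0"
  proof -
    have "(\<lambda>n. (2 * real n + 1) * B / real (n\<^sup>2)) \<longlonglongrightarrow> 0"
      by real_asymp
    then show ?thesis
      unfolding e_def using tendsto_add[OF tendsto_rabs_zero[OF squares]] by fastforce
  qed
  ultimately have lim: "(\<lambda>T. e (r T)) \<longlonglongrightarrow> 0"
    by (rule filterlim_compose[rotated])
  show ?thesis
  proof (rule Lim_null_comparison[OF _ lim])
    show "eventually (\<lambda>T. norm ((\<Sum>t<T. d t) / real T) \<le> e (r T)) sequentially"
      using eventually_gt_at_top[of 0]
    proof eventually_elim
      case (elim T)
      define n where "n = r T"
      have lo: "n\<^sup>2 \<le> T" and hi: "T < (Suc n)\<^sup>2" and n: "0 < n"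
        using elim by (auto simp: n_def r_def Suc_floor_sqrt_power2_gt)
      have "(\<Sum>t<T. d t) = (\<Sum>t<n\<^sup>2. d t) + (\<Sum>t=n\<^sup>2..<T. d t)"
        using lo by (metis atLeast0LessThan sum.atLeastLessThan_concat zero_le)
      moreover have "\<bar>\<Sum>t=n\<^sup>2..<T. d t\<bar> \<le> (2 * real n + 1) * B"
      proof -
        have "\<bar>\<Sum>t=n\<^sup>2..<T. d t\<bar> \<le> (\<Sum>t=n\<^sup>2..<T. B)"
          by (rule order_trans[OF sum_abs sum_mono]) (use bound in auto)
        also have "\<dots> = real (T - n\<^sup>2) * B"
          by simp
        also have "T - n\<^sup>2 \<le> 2 * n + 1"
          using hi by (simp add: power2_eq_square)
        then have "real (T - n\<^sup>2) * B \<le> (2 * real n + 1) * B"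
          using B by (intro mult_right_mono) linarith+
        finally show ?thesis .
      qed
      ultimately have "\<bar>\<Sum>t<T. d t\<bar> \<le> \<bar>\<Sum>t<n\<^sup>2. d t\<bar> + (2 * real n + 1) * B"
        by linarith
      then have "\<bar>\<Sum>t<T. d t\<bar> / real T \<le> (\<bar>\<Sum>t<n\<^sup>2. d t\<bar> + (2 * real n + 1) * B) / real (n\<^sup>2)"
        using n lo B by (intro frac_le) (auto simp del: of_nat_power)
      then show ?case
        by (simp add: e_def n_def add_divide_distrib)
    qed
  qed
qed

text \<open>The squared averages at the times \<open>n\<^sup>2\<close> have expectations at most \<open>B\<^sup>2 / n\<^sup>2\<close>. Their sum over \<open>n\<close>
  has a finite expectation, hence is almost surely finite, and its terms tend to \<open>0\<close>.\<close>

lemma strong_law_play: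
  fixes \<sigma> :: "('m::finite, 'n::finite) strategy1" and \<tau> :: "('m, 'n) strategy2"
    and D :: "('m \<times> 'n) list \<Rightarrow> 'm \<times> 'n \<Rightarrow> real"
  assumes bound: "\<And>h a. \<bar>D h a\<bar> \<le> B"
    and centred: "\<And>h. (\<integral>a. D h a \<partial>measure_pmf (pair_pmf (\<sigma> h) (\<tau> h))) = 0"
  shows "AE \<omega> in play_measure \<sigma> \<tau>. (\<lambda>T. (\<Sum>t<T. D (map \<omega> [0..<t]) (\<omega> t)) / real T) \<longlonglongrightarrow> 0"
proof -
  define W where "W T \<omega> = (\<Sum>t<T. D (map \<omega> [0..<t]) (\<omega> t))" for T \<omega>
  have [measurable]: "W T \<in> borel_measurable (play_measure \<sigma> \<tau>)" for T
  proof -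
    have "(\<lambda>\<omega>. (\<lambda>h. \<Sum>t<T. D (take t h) (h ! t)) (map \<omega> [0..<T])) \<in> borel_measurable (play_measure \<sigma> \<tau>)"
      by measurable
    also have "(\<lambda>\<omega>. (\<lambda>h. \<Sum>t<T. D (take t h) (h ! t)) (map \<omega> [0..<T])) = W T"
      by (auto simp: W_def fun_eq_iff take_map intro!: sum.cong)
    finally show ?thesis .
  qed
  let ?Q = "\<lambda>n \<omega>. ennreal ((W (n\<^sup>2) \<omega> / real (n\<^sup>2))\<^sup>2)"
  have moment: "(\<integral>\<^sup>+\<omega>. ?Q n \<omega> \<partial>play_measure \<sigma> \<tau>) \<le> ennreal (B\<^sup>2 * inverse (real n ^ 2))" for n
  proof (cases "n = 0")
    case False
    have "(\<integral>\<^sup>+\<omega>. ?Q n \<omega> \<partial>play_measure \<sigma> \<tau>) =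
        (\<integral>\<^sup>+\<omega>. ennreal (inverse (real n ^ 4)) * ennreal ((W (n\<^sup>2) \<omega>)\<^sup>2) \<partial>play_measure \<sigma> \<tau>)"
      by (simp add: field_simps flip: ennreal_mult)
    also have "\<dots> = ennreal (inverse (real n ^ 4)) * (\<integral>\<^sup>+\<omega>. ennreal ((W (n\<^sup>2) \<omega>)\<^sup>2) \<partial>play_measure \<sigma> \<tau>)"
      by (rule nn_integral_cmult) measurable
    also have "\<dots> \<le> ennreal (inverse (real n ^ 4)) * ennreal (real (n\<^sup>2) * B\<^sup>2)"
      unfolding W_def by (intro mult_left_mono second_moment_martingale bound centred) simp
    also have "\<dots> = ennreal (B\<^sup>2 * inverse (real n ^ 2))"
      using False by (simp add: field_simps flip: ennreal_mult)
    finally show ?thesis .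
  qed simp
  have "(\<integral>\<^sup>+\<omega>. (\<Sum>n. ?Q n \<omega>) \<partial>play_measure \<sigma> \<tau>) = (\<Sum>n. \<integral>\<^sup>+\<omega>. ?Q n \<omega> \<partial>play_measure \<sigma> \<tau>)"
    by (rule nn_integral_suminf) measurable
  also have "\<dots> \<le> (\<Sum>n. ennreal (B\<^sup>2 * inverse (real n ^ 2)))"
    by (intro suminf_le moment) auto
  also have "\<dots> = ennreal (\<Sum>n. B\<^sup>2 * inverse (real n ^ 2))"
    by (intro suminf_ennreal2 summable_mult inverse_power_summable) auto
  also have "\<dots> < \<infinity>"
    by simp
  finally have "AE \<omega> in play_measure \<sigma> \<tau>. (\<Sum>n. ?Q n \<omega>) \<noteq> \<infinity>"
    by (intro nn_integral_PInf_AE) auto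
  then show ?thesis
  proof eventually_elim
    case (elim \<omega>)
    have "summable (\<lambda>n. (W (n\<^sup>2) \<omega> / real (n\<^sup>2))\<^sup>2)"
      using elim by (intro summable_suminf_not_top) (auto simp: top_unique infinity_ennreal_def)
    then have "(\<lambda>n. (W (n\<^sup>2) \<omega> / real (n\<^sup>2))\<^sup>2) \<longlonglongrightarrow> 0"
      by (rule summable_LIMSEQ_zero)
    then have "(\<lambda>n. W (n\<^sup>2) \<omega> / real (n\<^sup>2)) \<longlonglongrightarrow> 0"
      using tendsto_real_sqrt[of _ 0] by (simp add: tendsto_rabs_zero_iff)
    then show ?case
      unfolding W_def by (rule averages_tendsto_0_of_squares[rotated]) (rule bound)
  qed
qed


section \<open>The minimax theorem for matrix games\<close>

lemma mixed_inner_le: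
  assumes "x \<in> mixed" and "\<And>i. v $ i \<le> b"
  shows "x \<bullet> v \<le> b"
proof -
  have "x \<bullet> v \<le> (\<Sum>i\<in>UNIV. x $ i * b)"
    unfolding inner_vec_def using assms by (auto simp: mixed_def intro!: sum_mono mult_left_mono)
  also have "\<dots> = b"
    using assms(1) by (simp add: mixed_def flip: sum_distrib_right)
  finally show ?thesis .
qed

lemma axis_in_mixed: "axis k 1 \<in> mixed"
  by (auto simp: mixed_def axis_def)

lemma convex_mixed: "convex mixed"
  unfolding convex_def mixed_def
  by (auto simp: sum.distrib simp flip: sum_distrib_left)

text \<open>Von Neumann's minimax theorem in threshold form: if every mixed column action costs at least \<open>w\<close>
  against some row, then one mixed row action earns at least \<open>w\<close> against every column. The cost
  vectors \<open>B y\<close> form a convex set disjoint from the open orthant below \<open>(w, \<dots>, w)\<close>, and the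
  normal of a separating hyperplane, scaled to total mass \<open>1\<close>, is the required row action.\<close>

lemma minimax_threshold:
  fixes B :: "real ^ 'n ^ 'm"
  assumes "\<And>y. y \<in> mixed \<Longrightarrow> \<exists>i. w \<le> (B *v y) $ i"
  obtains x where "x \<in> mixed" and "\<And>j. w \<le> (\<Sum>i\<in>UNIV. x $ i * B $ i $ j)"
proof -
  let ?T = "{z :: real ^ 'm. \<forall>i. z $ i < w}"
  define one :: "real ^ 'm" where "one = (\<chi> i. 1)"
  have sc: "u *\<^sub>R one \<in> ?T" if "u < w" for u
    using that by (simp add: one_def)
  have "convex ?T"
    unfolding convex_def by (auto intro: convex_bound_lt)
  moreover have "convex ((*v) B ` mixed)"
    by (intro convex_linear_image matrix_vector_mul_linear convex_mixed)
  moreover have "?T \<noteq> {}"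
    using sc[of "w - 1"] by (metis diff_less empty_iff less_add_one zero_less_one diff_less_eq)
  moreover have "(*v) B ` (mixed :: (real ^ 'n) set) \<noteq> {}"
    using axis_in_mixed by blast
  moreover have "?T \<inter> (*v) B ` mixed = {}"
  proof (intro equals0I)
    fix z assume "z \<in> ?T \<inter> (*v) B ` mixed"
    then obtain y where "y \<in> mixed" "\<forall>i. (B *v y) $ i < w"
      by auto
    then show False
      using assms[of y] by (auto simp: not_le[symmetric])
  qed
  ultimately obtain a b where "a \<noteq> 0" and T: "\<And>z. z \<in> ?T \<Longrightarrow> a \<bullet> z \<le> b"
    and S: "\<And>y. y \<in> mixed \<Longrightarrow> b \<le> a \<bullet> (B *v y)"
    using separating_hyperplane_sets[of ?T "(*v) B ` mixed"] by (metis imageI)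
  (* The orthant is unbounded in each direction - axis i 1, on which a must stay bounded above. *)
  have a: "0 \<le> a $ i" for i
  proof (rule ccontr)
    assume neg: "\<not> 0 \<le> a $ i"
    let ?z = "(w - 1) *\<^sub>R one"
    define s where "s = (b - a \<bullet> ?z + 1) / (- a $ i)"
    have "0 \<le> s"
      using neg T[OF sc[of "w - 1"]] unfolding s_def by (intro divide_nonneg_nonneg) auto
    then have "?z - s *\<^sub>R axis i 1 \<in> ?T"
      by (auto simp: one_def axis_def)
    from T[OF this] have "a \<bullet> ?z - s * a $ i \<le> b"
      by (simp add: inner_diff_right inner_axis del: inner_scaleR_right) (simp add: inner_axis)
    moreover have "s * a $ i = - (b - a \<bullet> ?z + 1)"
      using neg by (simp add: s_def)
    ultimately show False
      by linarith
  qed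
  define p where "p = (\<Sum>i\<in>UNIV. a $ i)"
  obtain i where "a $ i \<noteq> 0"
    using \<open>a \<noteq> 0\<close> by (auto simp: vec_eq_iff)
  then have p: "0 < p"
    unfolding p_def using a by (intro sum_pos2[of _ i]) (auto simp: less_le)
  (* The corner (w, ..., w) is only in the closure of the orthant. *)
  have "w * p \<le> b"
  proof (rule field_le_epsilon)
    fix e :: real assume "0 < e"
    moreover have "a \<bullet> one = p"
      by (simp add: one_def inner_vec_def p_def)
    ultimately have "(w - e / p) * p \<le> b"
      using T[OF sc[of "w - e / p"]] p by simp
    then show "w * p \<le> b + e"
      using p by (simp add: left_diff_distrib)
  qed
  show thesis
  proof
    show "(1 / p) *\<^sub>R a \<in> mixed"
      using a p by (simp add: mixed_def p_def flip: sum_divide_distrib)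
    fix j
    have "w * p \<le> a \<bullet> (B *v axis j 1)"
      using \<open>w * p \<le> b\<close> S[OF axis_in_mixed] by (rule order_trans)
    also have "\<dots> = (\<Sum>i\<in>UNIV. a $ i * B $ i $ j)"
      by (simp add: inner_vec_def matrix_vector_mult_basis column_def)
    finally show "w \<le> (\<Sum>i\<in>UNIV. ((1 / p) *\<^sub>R a) $ i * B $ i $ j)"
      using p by (simp add: field_simps flip: sum_divide_distrib)
  qed
qed


section \<open>Bounds on the value from conditional stage payoffs\<close>

text \<open>The stage payoff as a function of the past and the current action pair, so that it can be averaged
  against the strategies with the past held fixed.\<close>

definition history_payoff ::
  "real ^ 'n ^ 'm \<Rightarrow> real ^ 'n ^ 'n \<Rightarrow> real \<Rightarrow> ('m \<times> 'n) list \<Rightarrow> 'm \<times> 'n \<Rightarrow> real" where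
  "history_payoff A S c h a =
     A $ fst a $ snd a + (if h = [] then 0 else c * S $ snd (last h) $ snd a)"

lemma stage_payoff_eq_history_payoff:
  "stage_payoff A S c \<omega> t = history_payoff A S c (map \<omega> [0..<t]) (\<omega> t)"
  by (auto simp: stage_payoff_def history_payoff_def last_conv_nth)

lemma history_payoff_bounded:
  fixes A :: "real ^ 'n::finite ^ 'm::finite"
  obtains B where "\<And>h a. \<bar>history_payoff A S c h a\<bar> \<le> B"
proof -
  obtain B where B: "\<And>\<omega> t. \<bar>stage_payoff A S c \<omega> t\<bar> \<le> B"
    using stage_payoff_bounded by blast
  have "\<bar>history_payoff A S c h a\<bar> \<le> B" for h a
  proof -
    (* Any play that continues h by a. *)
    define \<omega> where "\<omega> t = (if t < length h then h ! t else a)" for t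
    have "map \<omega> [0..<length h] = h"
      by (auto simp: \<omega>_def intro: nth_equalityI)
    then show ?thesis
      using B[of \<omega> "length h"] by (simp add: stage_payoff_eq_history_payoff \<omega>_def)
  qed
  then show thesis
    using that by blast
qed

text \<open>Besides bounding the payoff, this shows that the conversion to a real number in its definition loses
  nothing: the limit inferior is finite.\<close>

lemma long_run_payoff_bounded:
  fixes A :: "real ^ 'n::finite ^ 'm::finite"
  obtains B where "\<And>\<omega>. \<bar>long_run_payoff A S c \<omega>\<bar> \<le> B"
    and "\<And>\<omega>. ereal (long_run_payoff A S c \<omega>) =
           liminf (\<lambda>T. ereal ((\<Sum>t<T. stage_payoff A S c \<omega> t) / real T))"
proof -
  obtain B where B: "0 \<le> B" "\<And>\<omega> t. \<bar>stage_payoff A S c \<omega> t\<bar> \<le> B"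
    using stage_payoff_bounded by blast
  have avg: "\<bar>(\<Sum>t<T. stage_payoff A S c \<omega> t) / real T\<bar> \<le> B" for \<omega> T
  proof -
    have "\<bar>\<Sum>t<T. stage_payoff A S c \<omega> t\<bar> \<le> real T * B"
      using B by (intro order_trans[OF sum_abs] order_trans[OF sum_bounded_above]) auto
    then show ?thesis
      using B(1) by (cases "T = 0") (auto simp: field_simps)
  qed
  let ?X = "\<lambda>\<omega> T. ereal ((\<Sum>t<T. stage_payoff A S c \<omega> t) / real T)"
  have b: "ereal (- B) \<le> ?X \<omega> T" "?X \<omega> T \<le> ereal B" for \<omega> T
    using avg[of \<omega> T] by (simp_all only: ereal_less_eq abs_le_iff) linarith+
  have lo: "ereal (- B) \<le> liminf (?X \<omega>)" for \<omega>
    by (rule Liminf_bounded) (use b in auto)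
  have hi: "liminf (?X \<omega>) \<le> ereal B" for \<omega>
    by (rule order_trans[OF Liminf_le_Limsup Limsup_bounded]) (use b in auto)
  have eq: "ereal (long_run_payoff A S c \<omega>) = liminf (?X \<omega>)" for \<omega>
    using lo[of \<omega>] hi[of \<omega>] unfolding long_run_payoff_def by (cases "liminf (?X \<omega>)") auto
  moreover have "\<bar>long_run_payoff A S c \<omega>\<bar> \<le> B" for \<omega>
    using lo[of \<omega>] hi[of \<omega>] unfolding eq[symmetric] by (simp add: abs_le_iff)
  ultimately show thesis
    using that by blast
qed

lemma integrable_long_run_payoff:
  fixes \<sigma> :: "('m::finite, 'n::finite) strategy1" and \<tau> :: "('m, 'n) strategy2"
  shows "integrable (play_measure \<sigma> \<tau>) (long_run_payoff A S c)"
proof -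
  interpret prob_space "play_measure \<sigma> \<tau>"
    by (rule prob_space_play_measure)
  have [measurable]: "(\<lambda>\<omega>. stage_payoff A S c \<omega> t) \<in> borel_measurable (play_measure \<sigma> \<tau>)" for t
  proof -
    have "(\<lambda>\<omega>. (\<lambda>h. history_payoff A S c (take t h) (h ! t)) (map \<omega> [0..<Suc t]))
        \<in> borel_measurable (play_measure \<sigma> \<tau>)"
      by measurable
    also have "(\<lambda>\<omega>. (\<lambda>h. history_payoff A S c (take t h) (h ! t)) (map \<omega> [0..<Suc t]))
        = (\<lambda>\<omega>. stage_payoff A S c \<omega> t)"
      by (simp add: stage_payoff_eq_history_payoff nth_append fun_eq_iff)
    finally show ?thesis .
  qed
  have [measurable]: "long_run_payoff A S c \<in> borel_measurable (play_measure \<sigma> \<tau>)"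
    unfolding long_run_payoff_def[abs_def] by measurable
  obtain B where "\<And>\<omega>. \<bar>long_run_payoff A S c \<omega>\<bar> \<le> B"
    using long_run_payoff_bounded by blast
  then show ?thesis
    by (intro integrable_const_bound[of _ B]) auto
qed

abbreviation expected_stage_payoff ::
  "real ^ 'n ^ 'm \<Rightarrow> real ^ 'n ^ 'n \<Rightarrow> real \<Rightarrow> ('m, 'n) strategy1 \<Rightarrow> ('m, 'n) strategy2 \<Rightarrow>
    ('m \<times> 'n) list \<Rightarrow> real" where
  "expected_stage_payoff A S c \<sigma> \<tau> h \<equiv>
     (\<integral>a. history_payoff A S c h a \<partial>measure_pmf (pair_pmf (\<sigma> h) (\<tau> h)))"

text \<open>Subtracting from each stage payoff its conditional expectation leaves bounded martingale
  differences, to which the strong law applies.\<close>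

lemma long_run_payoff_compensated:
  fixes \<sigma> :: "('m::finite, 'n::finite) strategy1" and \<tau> :: "('m, 'n) strategy2"
  shows "AE \<omega> in play_measure \<sigma> \<tau>.
    (\<lambda>T. (\<Sum>t<T. stage_payoff A S c \<omega> t - expected_stage_payoff A S c \<sigma> \<tau> (map \<omega> [0..<t])) / real T) \<longlonglongrightarrow> 0"
proof -
  obtain B where B: "\<And>h a. \<bar>history_payoff A S c h a\<bar> \<le> B"
    using history_payoff_bounded by blast
  let ?m = "expected_stage_payoff A S c \<sigma> \<tau>"
  have int: "integrable (measure_pmf (pair_pmf (\<sigma> h) (\<tau> h))) f" for h and f :: "'m \<times> 'n \<Rightarrow> real"
    by (intro integrable_measure_pmf_finite) simp
  have m: "\<bar>?m h\<bar> \<le> B" for h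
  proof -
    have "\<bar>?m h\<bar> \<le> (\<integral>a. \<bar>history_payoff A S c h a\<bar> \<partial>measure_pmf (pair_pmf (\<sigma> h) (\<tau> h)))"
      by (rule integral_abs_bound)
    also have "\<dots> \<le> (\<integral>a. B \<partial>measure_pmf (pair_pmf (\<sigma> h) (\<tau> h)))"
      by (intro integral_mono int B)
    finally show ?thesis
      by simp
  qed
  show ?thesis
    unfolding stage_payoff_eq_history_payoff
  proof (rule strong_law_play)
    show "\<bar>history_payoff A S c h a - ?m h\<bar> \<le> B + B" for h a
      using B[of h a] m[of h] by linarith
    show "(\<integral>a. history_payoff A S c h a - ?m h \<partial>measure_pmf (pair_pmf (\<sigma> h) (\<tau> h))) = 0" for h
      by (simp add: int)
  qed
qed

lemma shifted_average_tendsto: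
  fixes d :: "nat \<Rightarrow> real"
  assumes "(\<lambda>T. d T / real T) \<longlonglongrightarrow> 0"
  shows "(\<lambda>T. ereal (d T / real T + (w + e / real T))) \<longlonglongrightarrow> ereal w"
proof -
  have "(\<lambda>T. w + e / real T) \<longlonglongrightarrow> w"
    by real_asymp
  from tendsto_add[OF assms this] show ?thesis
    by simp
qed

text \<open>The first stage is split off because it has no preceding state: a strategy that reacts to the state
  controls the conditional expectations \<open>m t\<close> only for \<open>t \<ge> 1\<close>, and the error \<open>(m 0 - w)/T\<close>
  made at stage \<open>0\<close> vanishes in the limit.\<close>

lemma sum_first_stage:
  fixes m :: "nat \<Rightarrow> real"
  assumes "0 < T"
  shows "(\<Sum>t<T. u t) / real T = (\<Sum>t<T. u t - m t) / real T + (\<Sum>t=1..<T. m t - w) / real T + (w + (m 0 - w) / real T)"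
proof -
  have "(\<Sum>t<T. m t - w) = (m 0 - w) + (\<Sum>t=1..<T. m t - w)"
    using assms by (simp add: lessThan_atLeast0 sum.atLeast_Suc_lessThan)
  then have "(\<Sum>t<T. u t) = (\<Sum>t<T. u t - m t) + (\<Sum>t=1..<T. m t - w) + (real T * w + (m 0 - w))"
    by (simp add: sum_subtractf)
  then show ?thesis
    using assms by (simp only:) (simp add: add_divide_distrib)
qed

text \<open>Almost surely the average payoff differs by a null sequence from the average of the conditional
  expectations, so a bound on the latter passes to the limit inferior.\<close>

lemma payoff_geI:
  fixes \<sigma> :: "('m::finite, 'n::finite) strategy1" and \<tau> :: "('m, 'n) strategy2"
  assumes "\<And>h. h \<noteq> [] \<Longrightarrow> w \<le> expected_stage_payoff A S c \<sigma> \<tau> h"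
  shows "w \<le> payoff A S c \<sigma> \<tau>"
proof -
  interpret prob_space "play_measure \<sigma> \<tau>"
    by (rule prob_space_play_measure)
  have "AE \<omega> in play_measure \<sigma> \<tau>. w \<le> long_run_payoff A S c \<omega>"
    using long_run_payoff_compensated[where A = A and S = S and c = c and \<sigma> = \<sigma> and \<tau> = \<tau>]
  proof eventually_elim
    case (elim \<omega>)
    let ?m = "\<lambda>t. expected_stage_payoff A S c \<sigma> \<tau> (map \<omega> [0..<t])"
    let ?g = "\<lambda>T. (\<Sum>t<T. stage_payoff A S c \<omega> t - ?m t) / real T + (w + (?m 0 - w) / real T)"
    have "ereal w = liminf (\<lambda>T. ereal (?g T))"
      by (intro lim_imp_Liminf[symmetric] shifted_average_tendsto elim) simp
    also have "\<dots> \<le> liminf (\<lambda>T. ereal ((\<Sum>t<T. stage_payoff A S c \<omega> t) / real T))"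
    proof (rule Liminf_mono)
      show "eventually (\<lambda>T. ereal (?g T) \<le> ereal ((\<Sum>t<T. stage_payoff A S c \<omega> t) / real T)) sequentially"
        (is "eventually ?P _")
      proof (rule eventually_mono[OF eventually_gt_at_top[of 0]])
        fix T :: nat assume T: "0 < T"
        have "0 \<le> (\<Sum>t=1..<T. ?m t - w) / real T"
          using assms by (intro divide_nonneg_nonneg sum_nonneg) auto
        then show "?P T"
          using sum_first_stage[OF T, of "stage_payoff A S c \<omega>" ?m w] by simp
      qed
    qed
    also have "\<dots> = ereal (long_run_payoff A S c \<omega>)"
      by (rule long_run_payoff_bounded[of A S c]) simp
    finally show ?case
      by simp
  qed
  then have "(\<integral>\<omega>. w \<partial>play_measure \<sigma> \<tau>) \<le> payoff A S c \<sigma> \<tau>"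
    unfolding payoff_def by (intro integral_mono_AE integrable_long_run_payoff) auto
  then show ?thesis
    by (simp add: prob_space)
qed

lemma payoff_leI:
  fixes \<sigma> :: "('m::finite, 'n::finite) strategy1" and \<tau> :: "('m, 'n) strategy2"
  assumes "\<And>h. h \<noteq> [] \<Longrightarrow> expected_stage_payoff A S c \<sigma> \<tau> h \<le> w"
  shows "payoff A S c \<sigma> \<tau> \<le> w"
proof -
  interpret prob_space "play_measure \<sigma> \<tau>"
    by (rule prob_space_play_measure)
  have "AE \<omega> in play_measure \<sigma> \<tau>. long_run_payoff A S c \<omega> \<le> w"
    using long_run_payoff_compensated[where A = A and S = S and c = c and \<sigma> = \<sigma> and \<tau> = \<tau>]
  proof eventually_elim
    case (elim \<omega>)
    let ?m = "\<lambda>t. expected_stage_payoff A S c \<sigma> \<tau> (map \<omega> [0..<t])"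
    let ?g = "\<lambda>T. (\<Sum>t<T. stage_payoff A S c \<omega> t - ?m t) / real T + (w + (?m 0 - w) / real T)"
    have "ereal (long_run_payoff A S c \<omega>) =
        liminf (\<lambda>T. ereal ((\<Sum>t<T. stage_payoff A S c \<omega> t) / real T))"
      by (rule long_run_payoff_bounded[of A S c]) simp
    also have "\<dots> \<le> liminf (\<lambda>T. ereal (?g T))"
    proof (rule Liminf_mono)
      show "eventually (\<lambda>T. ereal ((\<Sum>t<T. stage_payoff A S c \<omega> t) / real T) \<le> ereal (?g T)) sequentially"
        (is "eventually ?P _")
      proof (rule eventually_mono[OF eventually_gt_at_top[of 0]])
        fix T :: nat assume T: "0 < T"
        have "(\<Sum>t=1..<T. ?m t - w) / real T \<le> 0"
          using assms by (intro divide_nonpos_nonneg sum_nonpos) auto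
        then show "?P T"
          using sum_first_stage[OF T, of "stage_payoff A S c \<omega>" ?m w] by simp
      qed
    qed
    also have "\<dots> = ereal w"
      by (intro lim_imp_Liminf shifted_average_tendsto elim) simp
    finally show ?case
      by simp
  qed
  then have "payoff A S c \<sigma> \<tau> \<le> (\<integral>\<omega>. w \<partial>play_measure \<sigma> \<tau>)"
    unfolding payoff_def by (intro integral_mono_AE integrable_long_run_payoff) auto
  then show ?thesis
    by (simp add: prob_space)
qed

lemma expectation_pair_pmf_finite:
  fixes f :: "'a::finite \<times> 'b::finite \<Rightarrow> real"
  shows "(\<integral>a. f a \<partial>measure_pmf (pair_pmf p q)) = (\<Sum>i\<in>UNIV. \<Sum>j\<in>UNIV. pmf p i * pmf q j * f (i, j))"
  by (subst integral_measure_pmf_real[where A = UNIV])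
    (auto simp: sum.cartesian_product UNIV_Times_UNIV pmf_pair mult_ac intro!: sum.cong)

definition pmf_of_mixed :: "real ^ 'n::finite \<Rightarrow> 'n pmf" where
  "pmf_of_mixed y = embed_pmf (\<lambda>j. y $ j)"

lemma pmf_pmf_of_mixed:
  assumes "y \<in> mixed"
  shows "pmf (pmf_of_mixed y) j = y $ j"
  unfolding pmf_of_mixed_def
  by (rule pmf_embed_pmf)
    (use assms in \<open>auto simp: mixed_def nn_integral_count_space_finite sum_ennreal\<close>)

lemma sum_pmf_UNIV: "(\<Sum>j\<in>UNIV. pmf p j) = 1" for p :: "'a::finite pmf"
  by (intro sum_pmf_eq_1) auto

text \<open>A mixed action \<open>x k\<close> that secures \<open>w\<close> in the one-shot game with entries \<open>a\<^sub>i\<^sub>j + c s\<^sub>k\<^sub>j\<close>,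
  for each state \<open>k\<close>, makes up a stationary strategy that secures \<open>w\<close> in the repeated game.\<close>

lemma game_value_geI:
  fixes A :: "real ^ 'n::finite ^ 'm::finite"
  assumes x: "\<And>k. x k \<in> mixed"
    and w: "\<And>k j. w \<le> (\<Sum>i\<in>UNIV. x k $ i * (A $ i $ j + c * S $ k $ j))"
  shows "w \<le> game_value A S c"
proof -
  obtain B where B: "\<And>\<sigma> \<tau>. \<bar>payoff A S c \<sigma> \<tau>\<bar> \<le> B"
    using payoff_bounded by blast
  (* On the empty history, last h is an unspecified value; the first stage does not matter. *)
  define \<sigma> :: "('m, 'n) strategy1" where "\<sigma> h = pmf_of_mixed (x (snd (last h)))" for h
  have "w \<le> payoff A S c \<sigma> \<tau>" for \<tau>
  proof (rule payoff_geI)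
    fix h :: "('m \<times> 'n) list" assume "h \<noteq> []"
    let ?k = "snd (last h)"
    have "w = (\<Sum>j\<in>UNIV. pmf (\<tau> h) j * w)"
      by (simp add: sum_pmf_UNIV flip: sum_distrib_right)
    also have "\<dots> \<le> (\<Sum>j\<in>UNIV. pmf (\<tau> h) j * (\<Sum>i\<in>UNIV. x ?k $ i * (A $ i $ j + c * S $ ?k $ j)))"
      by (intro sum_mono mult_left_mono w) simp
    also have "\<dots> = (\<Sum>i\<in>UNIV. \<Sum>j\<in>UNIV. x ?k $ i * pmf (\<tau> h) j * (A $ i $ j + c * S $ ?k $ j))"
      unfolding sum_distrib_left by (subst sum.swap) (simp add: mult_ac)
    also have "\<dots> = expected_stage_payoff A S c \<sigma> \<tau> h"
      using \<open>h \<noteq> []\<close> by (simp add: expectation_pair_pmf_finite history_payoff_def \<sigma>_def pmf_pmf_of_mixed[OF x])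
    finally show "w \<le> expected_stage_payoff A S c \<sigma> \<tau> h" .
  qed
  then have "w \<le> (INF \<tau>. payoff A S c \<sigma> \<tau>)"
    by (intro cINF_greatest) auto
  moreover have "(INF \<tau>. payoff A S c \<sigma> \<tau>) \<le> B" for \<sigma> :: "('m, 'n) strategy1"
  proof (rule cINF_lower2)
    show "bdd_below (range (payoff A S c \<sigma>))"
      using B by (intro bdd_belowI2[of _ "- B"]) (simp add: abs_le_iff minus_le_iff)
    show "payoff A S c \<sigma> undefined \<le> B"
      using B[of \<sigma> undefined] by linarith
  qed simp
  ultimately show ?thesis
    unfolding game_value_def by (intro cSUP_upper2[of _ _ \<sigma>] bdd_aboveI2[of _ _ B]) auto
qed

text \<open>The mirror image for Player 2. The value is the supremum of what Player 1 can
  guarantee, so any single strategy of Player 2 bounds it from above.\<close>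

lemma game_value_leI:
  fixes A :: "real ^ 'n::finite ^ 'm::finite"
  assumes y: "\<And>k. y k \<in> mixed"
    and w: "\<And>k i. (\<Sum>j\<in>UNIV. y k $ j * (A $ i $ j + c * S $ k $ j)) \<le> w"
  shows "game_value A S c \<le> w"
proof -
  obtain B where B: "\<And>\<sigma> \<tau>. \<bar>payoff A S c \<sigma> \<tau>\<bar> \<le> B"
    using payoff_bounded by blast
  define \<tau> :: "('m, 'n) strategy2" where "\<tau> h = pmf_of_mixed (y (snd (last h)))" for h
  have "payoff A S c \<sigma> \<tau> \<le> w" for \<sigma>
  proof (rule payoff_leI)
    fix h :: "('m \<times> 'n) list" assume "h \<noteq> []"
    let ?k = "snd (last h)"
    have "expected_stage_payoff A S c \<sigma> \<tau> h
        = (\<Sum>i\<in>UNIV. pmf (\<sigma> h) i * (\<Sum>j\<in>UNIV. y ?k $ j * (A $ i $ j + c * S $ ?k $ j)))"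
      using \<open>h \<noteq> []\<close>
      by (simp add: expectation_pair_pmf_finite history_payoff_def \<tau>_def pmf_pmf_of_mixed[OF y]
          sum_distrib_left mult_ac)
    also have "\<dots> \<le> (\<Sum>i\<in>UNIV. pmf (\<sigma> h) i * w)"
      by (intro sum_mono mult_left_mono w) simp
    also have "\<dots> = w"
      by (simp add: sum_pmf_UNIV flip: sum_distrib_right)
    finally show "expected_stage_payoff A S c \<sigma> \<tau> h \<le> w" .
  qed
  then show ?thesis
    unfolding game_value_def using B
    by (intro cSUP_least cINF_lower2[of _ _ \<tau>] bdd_belowI2[of _ "- B"]) (auto simp: abs_le_iff minus_le_iff)
qed


section \<open>Static strategies and the loss bound\<close>

lemma component_le_sum_abs: "v $ i \<le> (\<Sum>i\<in>UNIV. \<bar>v $ i\<bar>)" for v :: "real ^ 'n"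
proof -
  have "\<bar>v $ i\<bar> \<le> (\<Sum>i\<in>UNIV. \<bar>v $ i\<bar>)"
    by (rule member_le_sum) auto
  then show ?thesis
    by linarith
qed

lemma bdd_above_inner_mixed: "bdd_above ((\<lambda>x. x \<bullet> v + r) ` mixed)"
proof (rule bdd_aboveI2)
  show "x \<bullet> v + r \<le> (\<Sum>i\<in>UNIV. \<bar>v $ i\<bar>) + r" if "x \<in> mixed" for x
    using that by (intro add_right_mono mixed_inner_le component_le_sum_abs)
qed

lemma quadratic_form_le_max_static_switching:
  assumes "y \<in> mixed"
  shows "y \<bullet> (S *v y) \<le> max_static_switching S"
  unfolding max_static_switching_def
proof (rule cSUP_upper[OF assms])
  have "y \<bullet> (S *v y) \<le> (\<Sum>k\<in>UNIV. \<Sum>j\<in>UNIV. \<bar>S $ k $ j\<bar>)" if "y \<in> mixed" for y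
  proof (rule mixed_inner_le[OF that])
    fix k
    have "(S *v y) $ k = y \<bullet> S $ k"
      by (simp add: matrix_vector_mult_def inner_vec_def mult.commute)
    also have "\<dots> \<le> (\<Sum>j\<in>UNIV. \<bar>S $ k $ j\<bar>)"
      using that by (intro mixed_inner_le component_le_sum_abs)
    also have "\<dots> \<le> (\<Sum>k\<in>UNIV. \<Sum>j\<in>UNIV. \<bar>S $ k $ j\<bar>)"
      by (rule member_le_sum[of k UNIV "\<lambda>k. \<Sum>j\<in>UNIV. \<bar>S $ k $ j\<bar>"]) (auto intro: sum_nonneg)
    finally show "(S *v y) $ k \<le> (\<Sum>k\<in>UNIV. \<Sum>j\<in>UNIV. \<bar>S $ k $ j\<bar>)" .
  qed
  then show "bdd_above ((\<lambda>y. y \<bullet> (S *v y)) ` mixed)"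
    by (rule bdd_aboveI2)
qed

lemma nonneg_matrix_vector_mult:
  assumes "\<And>i j. 0 \<le> A $ i $ j" and "y \<in> mixed"
  shows "0 \<le> (A *v y) $ i"
  using assms by (auto simp: matrix_vector_mult_def mixed_def intro!: sum_nonneg)

lemma inner_mixed_nonneg:
  assumes "x \<in> mixed" and "\<And>i. 0 \<le> v $ i"
  shows "0 \<le> x \<bullet> v"
  using assms by (auto simp: inner_vec_def mixed_def intro!: sum_nonneg)

text \<open>Nonnegative payoffs and costs are what bounds the losses of all static strategies from below, so that
  the infimum in the static value is at most each of them.\<close>

lemma static_value_le:
  assumes "\<And>i j. 0 \<le> A $ i $ j" "\<And>k j. 0 \<le> S $ k $ j" "0 \<le> c"
    and y: "y \<in> mixed" and b: "\<And>i. (A *v y) $ i \<le> b"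
  shows "static_value A S c \<le> b + c * (y \<bullet> (S *v y))"
proof -
  let ?F = "\<lambda>y. SUP x\<in>mixed. x \<bullet> (A *v y) + c * (y \<bullet> (S *v y))"
  have "0 \<le> ?F y'" if "y' \<in> mixed" for y'
  proof (rule cSUP_upper2[OF bdd_above_inner_mixed axis_in_mixed])
    show "0 \<le> axis undefined 1 \<bullet> (A *v y') + c * (y' \<bullet> (S *v y'))"
      using assms(1-3) that
      by (intro add_nonneg_nonneg mult_nonneg_nonneg inner_mixed_nonneg nonneg_matrix_vector_mult
          axis_in_mixed) auto
  qed
  then have "bdd_below (?F ` mixed)"
    by (intro bdd_belowI2)
  then have "static_value A S c \<le> ?F y"
    unfolding static_value_def using y by (rule cINF_lower)
  also have "\<dots> \<le> b + c * (y \<bullet> (S *v y))"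
    using b axis_in_mixed by (intro cSUP_least add_right_mono mixed_inner_le) auto
  finally show ?thesis .
qed

text \<open>In the expanded form symmetry merges the two cross terms into \<open>(S y)\<^sub>k / 2\<close>, and the zero
  diagonal removes the term for staying at \<open>k\<close>.\<close>

lemma quadratic_form_half_pure:
  fixes S :: "real ^ 'n ^ 'n"
  assumes "transpose S = S" and "S $ k $ k = 0"
  shows "((1/2) *\<^sub>R (axis k 1 + y)) \<bullet> (S *v ((1/2) *\<^sub>R (axis k 1 + y)))
    = (S *v y) $ k / 2 + (y \<bullet> (S *v y)) / 4"
proof -
  have "y \<bullet> (S *v axis k 1) = (S *v y) $ k"
    by (metis assms(1) dot_lmul_matrix inner_axis' inner_commute mult.left_neutral real_inner_1_left transpose_matrix_vector)
  moreover have "axis k 1 \<bullet> (S *v axis k 1) = 0"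
    using assms(2) by (simp add: inner_axis' matrix_vector_mult_basis column_def)
  ultimately show ?thesis
    by (simp add: matrix_vector_mult_scaleR matrix_vector_right_distrib inner_add_left inner_add_right
        inner_axis' field_simps)
qed

text \<open>The comparison behind the loss bound. The row \<open>i\<close> is a best reply to \<open>y\<close>; the static strategy mixing \<open>y\<close> evenly
  with the pure action \<open>k\<close> loses at most
  \<open>1/2 + ((A y)\<^sub>i + c (S y)\<^sub>k) / 2 + cM/4\<close>.\<close>

lemma half_static_loss:
  fixes A :: "real ^ 'n ^ 'm" and S :: "real ^ 'n ^ 'n"
  assumes A: "\<And>i j. 0 \<le> A $ i $ j" "\<And>i j. A $ i $ j \<le> 1"
    and S: "\<And>k j. 0 \<le> S $ k $ j" "\<And>k. S $ k $ k = 0" "transpose S = S" and c: "0 \<le> c"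
    and y: "y \<in> mixed"
  shows "\<exists>i. 2 * static_value A S c - 1 - c / 2 * max_static_switching S \<le> (A *v y) $ i + c * (S *v y) $ k"
proof -
  define z where "z = (1/2) *\<^sub>R (axis k 1 + y)"
  have "Max (range (($) (A *v y))) \<in> range (($) (A *v y))"
    by (rule Max_in) auto
  then obtain i where "(A *v y) $ i = Max (range (($) (A *v y)))"
    by (metis imageE)
  then have i: "(A *v y) $ i' \<le> (A *v y) $ i" for i'
    by simp
  have z: "z \<in> mixed"
    using convexD[OF convex_mixed axis_in_mixed y, of "1/2" "1/2" k] by (simp add: z_def scaleR_add_right)
  have "(A *v z) $ i' \<le> 1/2 + (A *v y) $ i / 2" for i'
    using A(2)[of i' k] i[of i']
    by (simp add: z_def matrix_vector_mult_scaleR matrix_vector_right_distrib matrix_vector_mult_basis column_def)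
  then have "static_value A S c \<le> 1/2 + (A *v y) $ i / 2 + c * (z \<bullet> (S *v z))"
    by (intro static_value_le A S c z)
  also have "z \<bullet> (S *v z) = (S *v y) $ k / 2 + (y \<bullet> (S *v y)) / 4"
    unfolding z_def by (rule quadratic_form_half_pure[OF S(3,2)])
  also have "c * \<dots> \<le> c * ((S *v y) $ k / 2 + max_static_switching S / 4)"
    using quadratic_form_le_max_static_switching[OF y, of S] c by (intro mult_left_mono) auto
  finally show ?thesis
    by (intro exI[of _ i]) (simp add: field_simps)
qed

lemma game_value_ge_static:
  fixes A :: "real ^ 'n ^ 'm" and S :: "real ^ 'n ^ 'n"
  assumes A: "\<And>i j. 0 \<le> A $ i $ j" "\<And>i j. A $ i $ j \<le> 1"
    and S: "\<And>k j. 0 \<le> S $ k $ j" "\<And>k. S $ k $ k = 0" "transpose S = S" and c: "0 \<le> c"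
  shows "2 * static_value A S c - 1 - c / 2 * max_static_switching S \<le> game_value A S c" (is "?w \<le> _")
proof -
  have *: "\<forall>k. \<exists>x. x \<in> mixed \<and> (\<forall>j. ?w \<le> (\<Sum>i\<in>UNIV. x $ i * (A $ i $ j + c * S $ k $ j)))"
  proof
    fix k
    define B where "B = (\<chi> i j. A $ i $ j + c * S $ k $ j)"
    have "\<exists>i. ?w \<le> (B *v y) $ i" if "y \<in> mixed" for y
    proof -
      have "(B *v y) $ i = (A *v y) $ i + c * (S *v y) $ k" for i
        by (simp add: B_def matrix_vector_mult_def sum.distrib sum_distrib_left algebra_simps)
      then show ?thesis
        using half_static_loss[OF assms that, of k] by simp
    qed
    then obtain x where "x \<in> mixed" "\<And>j. ?w \<le> (\<Sum>i\<in>UNIV. x $ i * B $ i $ j)"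
      using minimax_threshold[of ?w B] by blast
    then show "\<exists>x. x \<in> mixed \<and> (\<forall>j. ?w \<le> (\<Sum>i\<in>UNIV. x $ i * (A $ i $ j + c * S $ k $ j)))"
      unfolding B_def by auto
  qed
  obtain x where "\<forall>k. x k \<in> mixed \<and> (\<forall>j. ?w \<le> (\<Sum>i\<in>UNIV. x k $ i * (A $ i $ j + c * S $ k $ j)))"
    using choice[OF *] by blast
  then show ?thesis
    by (intro game_value_geI[of x]) auto
qed

text \<open>Without this strict inequality the ratio of gains could have a zero denominator.\<close>

lemma game_value_less:
  fixes A :: "real ^ 'n ^ 'm" and S :: "real ^ 'n ^ 'n"
  assumes A: "\<And>i j. A $ i $ j \<le> 1"
    and pure: "\<not> one_shot_optimal A (pure_action l)"
    and S: "switching_cost_matrix S" and c: "0 \<le> c"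
  shows "game_value A S c < 1 + c * max_static_switching S"
proof (cases "c = 0")
  case True
  have "one_shot_loss A (pure_action l) \<le> 1"
    unfolding one_shot_loss_def pure_action_def
    using A axis_in_mixed by (intro cSUP_least mixed_inner_le) (auto simp: matrix_vector_mult_basis column_def)
  moreover obtain y where y: "y \<in> mixed" "one_shot_loss A y < one_shot_loss A (pure_action l)"
    using pure axis_in_mixed by (auto simp: one_shot_optimal_def pure_action_def not_le)
  moreover have "(A *v y) $ i \<le> one_shot_loss A y" for i
    unfolding one_shot_loss_def using bdd_above_inner_mixed[of "A *v y" 0]
    by (intro cSUP_upper2[OF _ axis_in_mixed[of i]]) (auto simp: inner_axis')
  then have "game_value A S c \<le> one_shot_loss A y"
    using True y(1)
    by (intro game_value_leI[of "\<lambda>_. y"]) (simp_all add: matrix_vector_mult_def mult.commute)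
  ultimately show ?thesis
    using True by simp
next
  case False
  have sum: "(\<Sum>j\<in>UNIV. axis k 1 $ j * f j) = f k" for k :: 'n and f :: "'n \<Rightarrow> real"
    by (simp add: axis_def if_distrib[of "\<lambda>x. x * _"] cong: if_cong)
  have "game_value A S c \<le> 1"
    using A S by (intro game_value_leI[of "\<lambda>k. axis k 1"] axis_in_mixed)
      (simp add: sum switching_cost_matrix_def)
  moreover have "0 < max_static_switching S"
  proof -
    obtain k j where kj: "S $ k $ j = 1"
      using S by (auto simp: switching_cost_matrix_def)
    (* Alternating evenly between two columns with a positive switching cost. *)
    define y :: "real ^ 'n" where "y = (1/2) *\<^sub>R (axis k 1 + axis j 1)"
    have y: "y \<in> mixed"
      using convexD[OF convex_mixed axis_in_mixed axis_in_mixed, of "1/2" "1/2" k j]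
      by (simp add: y_def scaleR_add_right)
    have nonneg: "0 \<le> S $ a $ b" for a b
      using S by (auto simp: switching_cost_matrix_def)
    have "0 < y \<bullet> (S *v y)"
      using nonneg[of k k] nonneg[of j k] nonneg[of j j] kj
      by (simp add: y_def matrix_vector_mult_scaleR matrix_vector_right_distrib inner_add_left
          inner_axis' matrix_vector_mult_basis column_def)
    also have "\<dots> \<le> max_static_switching S"
      by (rule quadratic_form_le_max_static_switching[OF y])
    finally show ?thesis .
  qed
  ultimately show ?thesis
    using False c by (auto intro: le_less_trans simp: mult_pos_pos)
qed

theorem theorem1:
  fixes A :: "real ^ 'n ^ 'm" and S :: "real ^ 'n ^ 'n" and c :: real
  assumes "Min {A $ i $ j | i j. True} = 0"
    and "Max {A $ i $ j | i j. True} = 1"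
    and "\<And>j. \<not> one_shot_optimal A (pure_action j)"
    and "switching_cost_matrix S"
    and "transpose S = S"
    and "0 \<le> c"
  shows "static_value A S c - game_value A S c
           \<le> 1/2 * (1 - game_value A S c) + c/4 * max_static_switching S
       \<and> (1 + c * max_static_switching S - static_value A S c)
           / (1 + c * max_static_switching S - game_value A S c) \<ge> 1/2"
proof -
  have "{A $ i $ j | i j. True} = (\<lambda>(i, j). A $ i $ j) ` UNIV"
    by auto
  then have fin: "finite {A $ i $ j | i j. True}"
    by simp
  have A: "0 \<le> A $ i $ j" "A $ i $ j \<le> 1" for i j
    using Min_le[OF fin, of "A $ i $ j"] Max_ge[OF fin, of "A $ i $ j"] assms(1,2) by auto
  have S: "0 \<le> S $ k $ j" "S $ k $ k = 0" for k j
    using assms(4) by (auto simp: switching_cost_matrix_def)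
  have lower: "2 * static_value A S c - 1 - c / 2 * max_static_switching S \<le> game_value A S c"
    using A S assms(5,6) by (rule game_value_ge_static)
  have upper: "game_value A S c < 1 + c * max_static_switching S"
    using A(2) assms(3,4,6) by (rule game_value_less)
  have "0 \<le> max_static_switching S"
    using quadratic_form_le_max_static_switching[OF axis_in_mixed, where S = S]
      inner_mixed_nonneg[OF axis_in_mixed nonneg_matrix_vector_mult[OF S(1) axis_in_mixed]]
    by (rule order_trans[rotated])
  then have "0 \<le> c * max_static_switching S"
    using assms(6) by simp
  then show ?thesis
    using lower upper by (simp add: field_simps)
qed

end
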